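(* For $a,b,c\in\mathbb{R}$ with $a^2+b^2+c^2\neq 0$, let $$\phi(t)=R(at)\oplus R(bt)\oplus R(ct),\qquad R(\theta)=\begin{pmatrix}\cos\theta&-\sin\theta\\ \sin\theta&\cos\theta\end{pmatrix}.$$ Call two triples of real numbers equivalent if one is obtained from the other by permuting the entries and replacing each entry $\alpha$ (independently) by an element of $\{\pm\alpha\}+2\pi\mathbb{Z}$. Then, up to this equivalence, the triples $(at_0,bt_0,ct_0)$ (with $t_0\in\mathbb{R}$) such that $\phi(t_0)$ is similar to an integer matrix and $at_0+bt_0+ct_0=0$ are exactly the following: $$\left(\tfrac{2\pi}{7},\tfrac{4\pi}{7},-\tfrac{6\pi}{7}\right),\ \left(\pi,-\tfrac{\pi}{6},-\tfrac{5\pi}{6}\right),\ \left(\tfrac{2\pi}{3},\tfrac{\pi}{6},-\tfrac{5\pi}{6}\right),\ \left(\pi,-\tfrac{\pi}{4},-\tfrac{3\pi}{4}\right),\ \left(\tfrac{\pi}{2},\tfrac{\pi}{4},-\tfrac{3\pi}{4}\right),$$ $$(2\pi,2\pi,-4\pi),\ (2\pi,-\pi,-\pi),\ \left(2\pi,-\tfrac{\pi}{2},-\tfrac{3\pi}{2}\right),\ \left(2\pi,-\tfrac{\pi}{3},-\tfrac{5\pi}{3}\right),\ \left(2\pi,-\tfrac{2\pi}{3},-\tfrac{4\pi}{3}\right),$$ $$\left(\pi,-\tfrac{\pi}{2},-\tfrac{\pi}{2}\right),\ \left(\pi,-\tfrac{2\pi}{3},-\tfrac{\pi}{3}\right),\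 \left(\tfrac{\pi}{3},\tfrac{\pi}{3},-\tfrac{2\pi}{3}\right),\ \left(\tfrac{2\pi}{3},\tfrac{2\pi}{3},-\tfrac{4\pi}{3}\right).$$
   Context: $A\oplus B$ denotes the block-diagonal matrix with blocks $A,B$. A real $n\times n$ matrix $A$ is similar to $B$ if $P^{-1}AP=B$ for some $P\in\mathsf{GL}(n,\mathbb{R})$; an integer matrix is one with all entries in $\mathbb{Z}$. *)

theory Defs
  imports Complex_Main "HOL-Library.Multiset" "Jordan_Normal_Form.Matrix"
begin

definition rotation_mat :: "real \<Rightarrow> real mat" where
  "rotation_mat \<theta> = mat_of_rows_list 2 [[cos \<theta>, - sin \<theta>], [sin \<theta>, cos \<theta>]]"

definition phi :: "real \<Rightarrow> real \<Rightarrow> real \<Rightarrow> real \<Rightarrow> real mat" where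
  "phi a b c t = diag_block_mat [rotation_mat (a * t), rotation_mat (b * t), rotation_mat (c * t)]"

(* The similarity is over the reals: the conjugating matrices have type real mat. *)
definition similar_to_integer_mat :: "real mat \<Rightarrow> bool" where
  "similar_to_integer_mat A \<longleftrightarrow> (\<exists>B. elements_mat B \<subseteq> \<int> \<and> similar_mat A B)"

definition angle_equiv :: "real \<Rightarrow> real \<Rightarrow> bool" where
  "angle_equiv \<alpha> \<beta> \<longleftrightarrow> (\<exists>k::int. \<beta> = \<alpha> + 2 * pi * of_int k \<or> \<beta> = - \<alpha> + 2 * pi * of_int k)"

(* Equality of the multisets says that (x, y, z) is a permutation of the entries of the
   first triple. *)
definition triple_equiv :: "real \<times> real \<times> real \<Rightarrow> real \<times> real \<times> real \<Rightarrow> bool" where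
  "triple_equiv = (\<lambda>(\<alpha>, \<beta>, \<gamma>) (\<alpha>', \<beta>', \<gamma>').
     \<exists>x y z. {#x, y, z#} = {#\<alpha>, \<beta>, \<gamma>#} \<and>
       angle_equiv x \<alpha>' \<and> angle_equiv y \<beta>' \<and> angle_equiv z \<gamma>')"

(* The parameters a, b, c vary along with the time t0, so this collects the triples
   arising from all the one-parameter groups phi a b c. *)
definition admissible_triples :: "(real \<times> real \<times> real) set" where
  "admissible_triples = {(a * t0, b * t0, c * t0) | a b c t0.
     a\<^sup>2 + b\<^sup>2 + c\<^sup>2 \<noteq> 0 \<and> similar_to_integer_mat (phi a b c t0) \<and>
     a * t0 + b * t0 + c * t0 = 0}"

definition listed_triples :: "(real \<times> real \<times> real) set" where
  "listed_triples =
    {(2 * pi / 7, 4 * pi / 7, - (6 * pi / 7)),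
     (pi, - (pi / 6), - (5 * pi / 6)),
     (2 * pi / 3, pi / 6, - (5 * pi / 6)),
     (pi, - (pi / 4), - (3 * pi / 4)),
     (pi / 2, pi / 4, - (3 * pi / 4)),
     (2 * pi, 2 * pi, - (4 * pi)),
     (2 * pi, - pi, - pi),
     (2 * pi, - (pi / 2), - (3 * pi / 2)),
     (2 * pi, - (pi / 3), - (5 * pi / 3)),
     (2 * pi, - (2 * pi / 3), - (4 * pi / 3)),
     (pi, - (pi / 2), - (pi / 2)),
     (pi, - (2 * pi / 3), - (pi / 3)),
     (pi / 3, pi / 3, - (2 * pi / 3)),
     (2 * pi / 3, 2 * pi / 3, - (4 * pi / 3))}"

end

theory Submission
  imports Defs "Jordan_Normal_Form.Char_Poly"
begin

text \<open>
  Put x = 2 cos \<alpha>, y = 2 cos \<beta>, z = 2 cos \<gamma>. The characteristic polynomial of the block matrix is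
  the product of the quadratics X^2 - x X + 1, X^2 - y X + 1 and X^2 - z X + 1, so the elementary
  symmetric functions e1 and e2 of x, y, z are integers when the matrix is similar to an integer
  one. The relation \<alpha> + \<beta> + \<gamma> = 0 gives e3 = e1^2 - 2 e2 - 4. Hence the pair (e1, e2) determines the
  triple up to equivalence. Only fourteen integer pairs belong to cubics with three real roots in
  [-2, 2], and they are the values of (e1, e2) at the fourteen listed triples.

  Conversely, a rotation with nonzero sine is similar to the companion matrix of X^2 - x X + 1. A
  complete set of conjugate values x is then turned into integers by changing to a rational basis
  of the field that they generate: 1, x in the quadratic cases, and the normal basis x, y, z for
  the angles 2\<pi>/7, 4\<pi>/7, 6\<pi>/7.
\<close>

section \<open>Cubics with roots in [-2, 2]\<close>

text \<open>
  The last four bounds say that the cubic with elementary symmetric functions a, b, c is nonnegative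
  at 2, that its derivative is nonnegative at 2 and -2, and that its discriminant is nonnegative.
\<close>

lemma integer_cubics:
  fixes a b c :: int
  assumes "-6 \<le> a" "a \<le> 6" "-12 \<le> b" "b \<le> 12" and c: "c = a\<^sup>2 - 2 * b - 4"
    and "8 - 4 * a + 2 * b - c \<ge> 0" "12 - 4 * a + b \<ge> 0"
    and "12 + 4 * a + b \<ge> 0"
    and "a\<^sup>2 * b\<^sup>2 - 4 * b ^ 3 - 4 * a ^ 3 * c + 18 * a * b * c - 27 * c\<^sup>2 \<ge> 0"
  shows "(a, b) \<in> {(-3, 3), (-2, -4), (-2, -3), (-2, -2), (-2, -1), (-2, 0), (-1, -3), (-1, -2),
    (0, -3), (0, -2), (1, -1), (2, 0), (4, 5), (6, 12)}"
proof -
  \<comment> \<open>Eliminating \<open>c\<close> leaves 13 * 25 pairs; quantifying over lists makes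
    the check executable.\<close>
  have *: "\<forall>a\<in>set [-6..6]. \<forall>b\<in>set [-12..12].
    8 - 4 * a + 2 * b - (a\<^sup>2 - 2 * b - 4) \<ge> 0 \<longrightarrow> 12 - 4 * a + b \<ge> 0 \<longrightarrow> 12 + 4 * a + b \<ge> 0 \<longrightarrow>
    a\<^sup>2 * b\<^sup>2 - 4 * b ^ 3 - 4 * a ^ 3 * (a\<^sup>2 - 2 * b - 4) + 18 * a * b * (a\<^sup>2 - 2 * b - 4)
      - 27 * (a\<^sup>2 - 2 * b - 4)\<^sup>2 \<ge> 0 \<longrightarrow>
    (a, b) \<in> set [(-3, 3), (-2, -4), (-2, -3), (-2, -2), (-2, -1), (-2, 0), (-1, -3), (-1, -2),
      (0, -3), (0, -2), (1, -1), (2, 0), (4, 5), (6, 12 :: int)]"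
    by code_simp
  have "a \<in> set [-6..6]" "b \<in> set [-12..12]" using assms(1-4) by (simp_all only: set_upto atLeastAtMost_iff)
  from *[rule_format, OF this assms(6-)[unfolded c]] show ?thesis by (simp only: list.set)
qed

text \<open>\<open>x'\<close> is a root of the monic cubic with roots \<open>x\<close>,
  \<open>y\<close>, \<open>z\<close>, so it equals one of them; \<open>y'\<close> and
  \<open>z'\<close> are then the roots of the remaining quadratic factor.\<close>

lemma elementary_symmetric_determine:
  fixes x y z x' y' z' :: "'a :: idom"
  assumes 1: "x + y + z = x' + y' + z'" and 2: "x * y + y * z + z * x = x' * y' + y' * z' + z' * x'"
    and 3: "x * y * z = x' * y' * z'"
  shows "(x', y', z') \<in> {(x, y, z), (x, z, y), (y, x, z), (y, z, x), (z, x, y), (z, y, x)}"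
proof -
  have *: "(y', z') \<in> {(v, w), (w, v)}" if "x' = u" "u + v + w = x + y + z"
    "u * v + v * w + w * u = x * y + y * z + z * x" for u v w
  proof -
    from that 1 have s: "z' = v + w - y'" by (auto simp: algebra_simps)
    have "u * v + v * w + w * u = u * y' + y' * (v + w - y') + (v + w - y') * u"
      using that(3) 2 unfolding s that(1) by simp
    then have "(y' - v) * (y' - w) = 0" by (simp add: algebra_simps)
    then show ?thesis using s by auto
  qed
  have "(x' - x) * (x' - y) * (x' - z) =
    x' * x' * x' - (x + y + z) * x' * x' + (x * y + y * z + z * x) * x' - x * y * z"
    by (simp add: algebra_simps)
  also have "\<dots> = 0" unfolding assms by (simp add: algebra_simps)
  finally have "(x' - x) * (x' - y) * (x' - z) = 0" .
  then consider "x' = x" | "x' = y" | "x' = z" by auto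
  then show ?thesis
  proof cases
    case 1 show ?thesis using *[of x y z] 1 by auto
  next
    case 2 show ?thesis using *[of y x z] 2 by (auto simp: algebra_simps)
  next
    case 3 show ?thesis using *[of z x y] 3 by (auto simp: algebra_simps)
  qed
qed

section \<open>Triples of angles and the symmetric functions of their doubled cosines\<close>

lemma angle_equiv_iff: "angle_equiv \<alpha> \<beta> \<longleftrightarrow> cos \<alpha> = cos \<beta>"
proof -
  \<comment> \<open>The difference of cosines is twice the product of these sines, whose zeros give
    the two sign choices in \<open>angle_equiv\<close>.\<close>
  have "cos \<alpha> = cos \<beta> \<longleftrightarrow> sin ((\<beta> - \<alpha>) / 2) = 0 \<or> sin ((\<alpha> + \<beta>) / 2) = 0"
    using cos_diff_cos[of \<alpha> \<beta>] by auto
  also have "sin ((\<beta> - \<alpha>) / 2) = 0 \<longleftrightarrow> (\<exists>k::int. \<beta> = \<alpha> + 2 * pi * of_int k)"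
    unfolding sin_zero_iff_int2 by (simp add: field_simps)
  also have "sin ((\<alpha> + \<beta>) / 2) = 0 \<longleftrightarrow> (\<exists>k::int. \<beta> = - \<alpha> + 2 * pi * of_int k)"
    unfolding sin_zero_iff_int2 by (simp add: field_simps)
  finally show ?thesis unfolding angle_equiv_def by blast
qed

text \<open>The left side is the discriminant of the cubic with roots \<open>x\<close>,
  \<open>y\<close>, \<open>z\<close>; over the reals the square makes it nonnegative.\<close>

lemma cubic_discriminant:
  fixes x y z :: "'a :: comm_ring_1"
  defines "e1 \<equiv> x + y + z" and "e2 \<equiv> x * y + y * z + z * x" and "e3 \<equiv> x * y * z"
  shows "e1\<^sup>2 * e2\<^sup>2 - 4 * e2 ^ 3 - 4 * e1 ^ 3 * e3 + 18 * e1 * e2 * e3 - 27 * e3\<^sup>2 =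
    ((x - y) * (y - z) * (z - x))\<^sup>2"
proof -
  \<comment> \<open>Symmetry in \<open>x\<close> and \<open>y\<close> allows rewriting in
    \<open>s\<close>, \<open>p\<close>, \<open>z\<close>, which shortens the expansion.\<close>
  define s p where sp: "s = x + y" "p = x * y"
  have e: "e1 = s + z" "e2 = p + s * z" "e3 = p * z"
    unfolding sp e1_def e2_def e3_def by (simp_all add: algebra_simps)
  have 1: "(x - y)\<^sup>2 = s\<^sup>2 - 4 * p" and 2: "(y - z) * (z - x) = s * z - p - z\<^sup>2"
    unfolding sp by (simp_all add: power2_eq_square algebra_simps)
  have "((x - y) * (y - z) * (z - x))\<^sup>2 = (s\<^sup>2 - 4 * p) * (s * z - p - z\<^sup>2)\<^sup>2"
    unfolding mult.assoc 2 power_mult_distrib 1 by simp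
  then show ?thesis
    unfolding e by (simp add: power2_eq_square power3_eq_cube algebra_simps)
qed

text \<open>The factor 2 turns the cosines into traces of the rotation blocks. Up to sign and an
  additive constant, \<open>cos_e1\<close> and \<open>cos_e2\<close> are then coefficients of the
  characteristic polynomial.\<close>

definition cos_e1 :: "real \<times> real \<times> real \<Rightarrow> real" where
  "cos_e1 = (\<lambda>(\<alpha>, \<beta>, \<gamma>). 2 * cos \<alpha> + 2 * cos \<beta> + 2 * cos \<gamma>)"

definition cos_e2 :: "real \<times> real \<times> real \<Rightarrow> real" where
  "cos_e2 = (\<lambda>(\<alpha>, \<beta>, \<gamma>). 2 * cos \<alpha> * (2 * cos \<beta>) + 2 * cos \<beta> * (2 * cos \<gamma>) + 2 * cos \<gamma> * (2 * cos \<alpha>))"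

text \<open>As e1^2 - 2 e2 is the sum of the squares, this is the relation x^2 + y^2 + z^2 - x y z =
  4.\<close>

lemma cos_product_of_sum_zero:
  fixes \<alpha> \<beta> \<gamma> :: real
  assumes "\<alpha> + \<beta> + \<gamma> = 0"
  shows "2 * cos \<alpha> * (2 * cos \<beta>) * (2 * cos \<gamma>) = (cos_e1 (\<alpha>, \<beta>, \<gamma>))\<^sup>2 - 2 * cos_e2 (\<alpha>, \<beta>, \<gamma>) - 4"
proof -
  have "\<gamma> = - (\<alpha> + \<beta>)" using assms by simp
  then have c: "cos \<gamma> = cos \<alpha> * cos \<beta> - sin \<alpha> * sin \<beta>" by (simp only: cos_minus cos_add)
  \<comment> \<open>After substituting for \<open>cos \<gamma>\<close>, the terms linear in the sine
    product cancel and only its square remains.\<close>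
  have "(sin \<alpha> * sin \<beta>)\<^sup>2 = (1 - (cos \<alpha>)\<^sup>2) * (1 - (cos \<beta>)\<^sup>2)"
    by (simp add: power_mult_distrib sin_squared_eq)
  then show ?thesis unfolding cos_e1_def cos_e2_def prod.case c
    by (simp add: power2_eq_square algebra_simps)
qed

text \<open>By \<open>cos_product_of_sum_zero\<close> the first two symmetric functions fix the
  third, hence the cosines up to order; cosines fix angles up to \<open>angle_equiv\<close>.\<close>

lemma triple_equiv_iff:
  assumes p: "p = (\<alpha>, \<beta>, \<gamma>)" "\<alpha> + \<beta> + \<gamma> = 0" and q: "q = (\<alpha>', \<beta>', \<gamma>')" "\<alpha>' + \<beta>' + \<gamma>' = 0"
  shows "triple_equiv p q \<longleftrightarrow> cos_e1 p = cos_e1 q \<and> cos_e2 p = cos_e2 q"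
proof
  assume "triple_equiv p q"
  then obtain x y z where m: "{#x, y, z#} = {#\<alpha>, \<beta>, \<gamma>#}"
    and c: "cos x = cos \<alpha>'" "cos y = cos \<beta>'" "cos z = cos \<gamma>'"
    unfolding p q triple_equiv_def angle_equiv_iff by auto
  from m have "(x, y, z) \<in> {(\<alpha>, \<beta>, \<gamma>), (\<alpha>, \<gamma>, \<beta>), (\<beta>, \<alpha>, \<gamma>), (\<beta>, \<gamma>, \<alpha>), (\<gamma>, \<alpha>, \<beta>), (\<gamma>, \<beta>, \<alpha>)}"
    by (auto simp: add_eq_conv_ex)
  then show "cos_e1 p = cos_e1 q \<and> cos_e2 p = cos_e2 q"
    unfolding p q cos_e1_def cos_e2_def prod.case c[symmetric] by (auto simp: algebra_simps)
next
  assume *: "cos_e1 p = cos_e1 q \<and> cos_e2 p = cos_e2 q"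
  from elementary_symmetric_determine[of "2 * cos \<alpha>" "2 * cos \<beta>" "2 * cos \<gamma>"
      "2 * cos \<alpha>'" "2 * cos \<beta>'" "2 * cos \<gamma>'"]
    * cos_product_of_sum_zero[OF p(2)] cos_product_of_sum_zero[OF q(2)]
  \<comment> \<open>Writing the permutations as an image lifts the matching of cosines to a matching
    of angles.\<close>
  have "(2 * cos \<alpha>', 2 * cos \<beta>', 2 * cos \<gamma>') \<in> (\<lambda>(\<alpha>, \<beta>, \<gamma>). (2 * cos \<alpha>, 2 * cos \<beta>, 2 * cos \<gamma>)) `
    {(\<alpha>, \<beta>, \<gamma>), (\<alpha>, \<gamma>, \<beta>), (\<beta>, \<alpha>, \<gamma>), (\<beta>, \<gamma>, \<alpha>), (\<gamma>, \<alpha>, \<beta>), (\<gamma>, \<beta>, \<alpha>)}"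
    (is "_ \<in> _ ` ?S") unfolding p q by (simp add: cos_e1_def cos_e2_def)
  then obtain x y z where
    m: "(x, y, z) \<in> {(\<alpha>, \<beta>, \<gamma>), (\<alpha>, \<gamma>, \<beta>), (\<beta>, \<alpha>, \<gamma>), (\<beta>, \<gamma>, \<alpha>), (\<gamma>, \<alpha>, \<beta>), (\<gamma>, \<beta>, \<alpha>)}"
    and c: "cos x = cos \<alpha>'" "cos y = cos \<beta>'" "cos z = cos \<gamma>'"
    by (elim imageE) (simp only: prod.case prod.inject split: prod.splits, force)
  from m have "{#x, y, z#} = {#\<alpha>, \<beta>, \<gamma>#}" by auto
  with c show "triple_equiv p q" unfolding p q triple_equiv_def angle_equiv_iff by auto
qed

text \<open>The doubled cosines are real roots in [-2, 2] of an integer cubic, which supplies the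
  hypotheses of \<open>integer_cubics\<close>.\<close>

lemma cos_e_in_listed_values:
  assumes s: "\<alpha> + \<beta> + \<gamma> = 0" and 1: "cos_e1 (\<alpha>, \<beta>, \<gamma>) \<in> \<int>" and 2: "cos_e2 (\<alpha>, \<beta>, \<gamma>) \<in> \<int>"
  shows "(cos_e1 (\<alpha>, \<beta>, \<gamma>), cos_e2 (\<alpha>, \<beta>, \<gamma>)) \<in> {(-3, 3), (-2, -4), (-2, -3), (-2, -2), (-2, -1),
    (-2, 0), (-1, -3), (-1, -2), (0, -3), (0, -2), (1, -1), (2, 0), (4, 5), (6, 12)}"
proof -
  define x y z where xyz: "x = 2 * cos \<alpha>" "y = 2 * cos \<beta>" "z = 2 * cos \<gamma>"
  from 1 2 obtain a b where ab: "cos_e1 (\<alpha>, \<beta>, \<gamma>) = of_int a" "cos_e2 (\<alpha>, \<beta>, \<gamma>) = of_int b"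
    by (auto elim!: Ints_cases)
  define c where "c = a\<^sup>2 - 2 * b - 4"
  have a: "of_int a = x + y + z" and b: "of_int b = x * y + y * z + z * x"
    using ab by (auto simp: cos_e1_def cos_e2_def xyz)
  have c: "of_int c = x * y * z"
    using cos_product_of_sum_zero[OF s] unfolding ab c_def xyz by simp
  have bd: "-2 \<le> x" "x \<le> 2" "-2 \<le> y" "y \<le> 2" "-2 \<le> z" "z \<le> 2"
    using cos_le_one cos_ge_minus_one unfolding xyz by (simp_all add: minus_le_iff)
  have pr: "\<bar>u * v\<bar> \<le> 4" if "-2 \<le> u" "u \<le> 2" "-2 \<le> v" "v \<le> 2" for u v :: real
  proof -
    have "\<bar>u\<bar> * \<bar>v\<bar> \<le> 2 * 2" using that by (intro mult_mono) auto
    then show ?thesis by (simp add: abs_mult)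
  qed
  have "real_of_int (-6) \<le> of_int a" "of_int a \<le> real_of_int 6" unfolding a using bd by auto
  moreover have "real_of_int (-12) \<le> of_int b" "of_int b \<le> real_of_int 12"
    unfolding b using pr[of x y] pr[of y z] pr[of z x] bd by auto
  \<comment> \<open>This and the next two bounds are products, or sums of products, of nonnegative
    numbers such as 2 - x and 2 + x.\<close>
  moreover have "real_of_int 0 \<le> of_int (8 - 4 * a + 2 * b - c)"
  proof -
    have "0 \<le> (2 - x) * (2 - y) * (2 - z)" using bd by (intro mult_nonneg_nonneg) auto
    then show ?thesis by (simp add: a b c algebra_simps)
  qed
  moreover have "real_of_int 0 \<le> of_int (12 - 4 * a + b)"
  proof -
    have "0 \<le> (2 - x) * (2 - y) + (2 - y) * (2 - z) + (2 - z) * (2 - x)"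
      using bd mult_nonneg_nonneg[of "2 - x" "2 - y"] mult_nonneg_nonneg[of "2 - y" "2 - z"]
        mult_nonneg_nonneg[of "2 - z" "2 - x"] by linarith
    then show ?thesis by (simp add: a b algebra_simps)
  qed
  moreover have "real_of_int 0 \<le> of_int (12 + 4 * a + b)"
  proof -
    have "0 \<le> (2 + x) * (2 + y) + (2 + y) * (2 + z) + (2 + z) * (2 + x)"
      using bd mult_nonneg_nonneg[of "2 + x" "2 + y"] mult_nonneg_nonneg[of "2 + y" "2 + z"]
        mult_nonneg_nonneg[of "2 + z" "2 + x"] by linarith
    then show ?thesis by (simp add: a b algebra_simps)
  qed
  moreover have "real_of_int 0 \<le>
    of_int (a\<^sup>2 * b\<^sup>2 - 4 * b ^ 3 - 4 * a ^ 3 * c + 18 * a * b * c - 27 * c\<^sup>2)"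
  proof -
    have "of_int (a\<^sup>2 * b\<^sup>2 - 4 * b ^ 3 - 4 * a ^ 3 * c + 18 * a * b * c - 27 * c\<^sup>2) =
      ((x - y) * (y - z) * (z - x))\<^sup>2"
      unfolding cubic_discriminant[symmetric] by (simp add: a b c)
    then show ?thesis by simp
  qed
  ultimately have "(a, b) \<in> {(-3, 3), (-2, -4), (-2, -3), (-2, -2), (-2, -1),
    (-2, 0), (-1, -3), (-1, -2), (0, -3), (0, -2), (1, -1), (2, 0), (4, 5), (6, 12)}"
    unfolding of_int_le_iff by (rule integer_cubics[OF _ _ _ _ c_def])
  then have "map_prod real_of_int real_of_int (a, b) \<in> map_prod real_of_int real_of_int `
    {(-3, 3), (-2, -4), (-2, -3), (-2, -2), (-2, -1), (-2, 0), (-1, -3), (-1, -2), (0, -3), (0, -2),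
    (1, -1), (2, 0), (4, 5), (6, 12)}"
    by (rule imageI)
  then show ?thesis unfolding ab by simp
qed

section \<open>Necessity: the characteristic polynomial\<close>

lemma rotation_mat_carrier [simp]: "rotation_mat \<theta> \<in> carrier_mat 2 2"
  by (rule carrier_matI) (simp_all add: rotation_mat_def mat_of_rows_list_def)

lemma char_poly_four_block_diag:
  fixes A D :: "'a :: idom mat"
  assumes A: "A \<in> carrier_mat n n" and D: "D \<in> carrier_mat m m"
  shows "char_poly (four_block_mat A (0\<^sub>m n m) (0\<^sub>m m n) D) = char_poly A * char_poly D"
    (is "char_poly ?M = _")
proof -
  have "char_poly_matrix ?M =
    four_block_mat (char_poly_matrix A) (0\<^sub>m n m) (0\<^sub>m m n) (char_poly_matrix D)"
    unfolding char_poly_matrix_def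
    by (rule eq_matI) (use A D in \<open>auto simp: one_poly_def\<close>)
  then show ?thesis unfolding char_poly_def
    using A D by (simp add: det_four_block_mat_lower_left_zero[of _ n _ m])
qed

lemma char_poly_diag_block:
  fixes As :: "'a :: idom mat list"
  assumes "\<forall>A\<in>set As. square_mat A"
  shows "char_poly (diag_block_mat As) = (\<Prod>A\<leftarrow>As. char_poly A)"
  using assms
proof (induction As)
  case Nil
  then show ?case by (simp add: char_poly_defs)
next
  case (Cons A As)
  then have "square_mat (diag_block_mat As)" by (intro diag_block_mat_square) auto
  with Cons show ?case
    by (simp add: Let_def char_poly_four_block_diag[OF carrier_matI[OF refl] carrier_matI[OF refl]])
qed

lemma det_mat_2:
  fixes A :: "'a :: comm_ring_1 mat"
  assumes A: "A \<in> carrier_mat 2 2"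
  shows "det A = A $$ (0,0) * A $$ (1,1) - A $$ (0,1) * A $$ (1,0)"
  using A by (subst laplace_expansion_column[OF A, of 0])
    (simp_all add: numeral_2_eq_2 cofactor_def det_single mat_delete_def)

lemma char_poly_rotation: "char_poly (rotation_mat \<theta>) = [:1, - (2 * cos \<theta>), 1:]"
proof -
  have "char_poly_matrix (rotation_mat \<theta>) \<in> carrier_mat 2 2" by simp
  from det_mat_2[OF this] show ?thesis unfolding char_poly_def
    using sin_cos_squared_add[of \<theta>]
    by (simp add: char_poly_matrix_def rotation_mat_def mat_of_rows_list_def power2_eq_square)
qed

text \<open>\<open>B\<close> is the \<open>of_int\<close> image of an integer matrix, and forming
  the characteristic polynomial commutes with ring homomorphisms.\<close>

lemma char_poly_integer_coeff:
  fixes B :: "'a :: {comm_ring_1, ring_char_0} mat"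
  assumes "elements_mat B \<subseteq> \<int>" and B: "B \<in> carrier_mat n n"
  shows "coeff (char_poly B) i \<in> \<int>"
proof -
  define C where "C = map_mat (\<lambda>x. SOME k. x = of_int k) B"
  have C: "C \<in> carrier_mat n n" using B by (simp add: C_def)
  have "of_int (SOME k. B $$ (i, j) = of_int k) = B $$ (i, j)" if "i < n" "j < n" for i j
  proof -
    have "B $$ (i, j) \<in> \<int>" using assms that by (intro subsetD[OF assms(1)]) auto
    then have "\<exists>k. B $$ (i, j) = of_int k" by (auto elim: Ints_cases)
    then show ?thesis by (metis (mono_tags, lifting) someI_ex)
  qed
  then have "B = map_mat of_int C" using B by (intro eq_matI) (auto simp: C_def)
  then show ?thesis by (simp add: of_int_hom.char_poly_hom[OF C])
qed

lemma integer_symmetric_functions: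
  assumes "similar_to_integer_mat (phi a b c t)"
  defines "x \<equiv> 2 * cos (a * t)" and "y \<equiv> 2 * cos (b * t)" and "z \<equiv> 2 * cos (c * t)"
  shows "x + y + z \<in> \<int>" "x * y + y * z + z * x \<in> \<int>"
proof -
  from assms obtain B where B: "elements_mat B \<subseteq> \<int>" "similar_mat (phi a b c t) B"
    unfolding similar_to_integer_mat_def by auto
  from similar_matD[OF B(2)] obtain n where "B \<in> carrier_mat n n" by auto
  from char_poly_integer_coeff[OF B(1) this]
  have *: "coeff (char_poly (phi a b c t)) i \<in> \<int>" for i
    unfolding char_poly_similar[OF B(2)] .
  have "char_poly (phi a b c t) = [:1, -x, 1:] * ([:1, -y, 1:] * [:1, -z, 1:])"
    unfolding phi_def x_def y_def z_def
    by (subst char_poly_diag_block)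
      (simp_all add: char_poly_rotation carrier_matD[OF rotation_mat_carrier] del: mult_pCons_left)
  \<comment> \<open>X^4 arises from two linear terms, or from the constant 1 of one of the three
    factors; the latter gives the 3.\<close>
  then have c: "coeff (char_poly (phi a b c t)) 5 = - (x + y + z)"
     "coeff (char_poly (phi a b c t)) 4 = x * y + y * z + z * x + 3"
    by (simp_all add: numeral_eq_Suc) (simp add: algebra_simps)
  show "x + y + z \<in> \<int>" using *[of 5] unfolding c by (simp only: minus_in_Ints_iff)
  have "x * y + y * z + z * x = (x * y + y * z + z * x + 3) - 3" by simp
  also have "\<dots> \<in> \<int>" using *[of 4] unfolding c by (rule Ints_diff) simp
  finally show "x * y + y * z + z * x \<in> \<int>" .
qed

section \<open>Sufficiency: integer forms of the listed matrices\<close>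

text \<open>For square matrices over a field a right inverse is two-sided, so two matrix identities
  free of triple products suffice.\<close>

lemma similar_mat_intertwine:
  fixes A B P Q :: "'a :: field mat"
  assumes A: "A \<in> carrier_mat n n" and B: "B \<in> carrier_mat n n"
    and P: "P \<in> carrier_mat n n" and Q: "Q \<in> carrier_mat n n"
    and PQ: "P * Q = 1\<^sub>m n" and AP: "A * P = P * B"
  shows "similar_mat A B"
proof (rule similar_matI[of A B P Q n])
  show "Q * P = 1\<^sub>m n" using mat_mult_left_right_inverse[OF P Q PQ] .
  have "P * B * Q = A * (P * Q)" unfolding AP[symmetric] using A P Q by simp
  then show "A = P * B * Q" unfolding PQ using A by simp
  show "{A, B, P, Q} \<subseteq> carrier_mat n n" "P * Q = 1\<^sub>m n" using assms by auto
qed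

lemma similar_to_integer_diag_block:
  assumes "\<forall>A\<in>set As. similar_to_integer_mat A"
  shows "similar_to_integer_mat (diag_block_mat As)"
proof -
  from assms obtain f where f: "elements_mat (f A) \<subseteq> \<int>" "similar_mat A (f A)" if "A \<in> set As" for A
    unfolding similar_to_integer_mat_def by metis
  have "similar_mat (diag_block_mat (map fst (map (\<lambda>A. (A, f A)) As)))
    (diag_block_mat (map snd (map (\<lambda>A. (A, f A)) As)))"
    by (rule similar_diag_mat_block_mat) (auto intro: f)
  moreover have "elements_mat (diag_block_mat (map f As)) \<subseteq> \<int>"
    using elements_diag_block_mat[of "map f As"] f(1) by fastforce
  ultimately show ?thesis unfolding similar_to_integer_mat_def by (auto simp: comp_def)
qed

lemma similar_to_integer_trans:
  "similar_mat A B \<Longrightarrow> similar_to_integer_mat B \<Longrightarrow> similar_to_integer_mat A"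
  unfolding similar_to_integer_mat_def by (meson similar_mat_trans)

lemma elements_mat_of_rows_list:
  assumes "\<forall>r\<in>set rs. length r = n \<and> set r \<subseteq> S"
  shows "elements_mat (mat_of_rows_list n rs) \<subseteq> S"
proof
  fix x assume "x \<in> elements_mat (mat_of_rows_list n rs)"
  then obtain i j where "i < length rs" "j < n" "x = rs ! i ! j"
    by (auto simp: mat_of_rows_list_def dest!: elements_matD)
  with assms show "x \<in> S" by (metis nth_mem subsetD)
qed

lemma mat_of_rows_list_carrier: "length rs = m \<Longrightarrow> mat_of_rows_list n rs \<in> carrier_mat m n"
  by (rule carrier_matI) (simp_all add: mat_of_rows_list_def)

text \<open>
  The entries are compared through \<open>list_all\<close> and \<open>sum_list\<close> so that the simplifier unfolds both
  sides for numeral n.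
\<close>

lemma mult_mat_eqI:
  assumes "A \<in> carrier_mat n n" "B \<in> carrier_mat n n" "C \<in> carrier_mat n n"
    and "list_all (\<lambda>i. list_all (\<lambda>j. (\<Sum>k\<leftarrow>[0..<n]. A $$ (i, k) * B $$ (k, j)) = C $$ (i, j))
      [0..<n]) [0..<n]"
  shows "A * B = C"
  using assms by (intro eq_matI) (auto simp: list_all_iff scalar_prod_def sum_list_distinct_conv_sum_set)

lemma mult_mat_eq_multI:
  assumes "A \<in> carrier_mat n n" "B \<in> carrier_mat n n" "C \<in> carrier_mat n n" "D \<in> carrier_mat n n"
    and "list_all (\<lambda>i. list_all (\<lambda>j. (\<Sum>k\<leftarrow>[0..<n]. A $$ (i, k) * B $$ (k, j)) =
      (\<Sum>k\<leftarrow>[0..<n]. C $$ (i, k) * D $$ (k, j))) [0..<n]) [0..<n]"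
  shows "A * B = C * D"
  using assms by (intro eq_matI) (auto simp: list_all_iff scalar_prod_def sum_list_distinct_conv_sum_set)

text \<open>Multiplication by X modulo X^2 - x X + 1 in the basis 1, X.\<close>

definition companion :: "real \<Rightarrow> real mat" where
  "companion x = mat_of_rows_list 2 [[0, -1], [1, x]]"

text \<open>The columns of \<open>?P\<close> are the first basis vector and its image under the
  rotation, independent exactly when the sine is nonzero.\<close>

lemma rotation_similar_companion:
  assumes "sin \<theta> \<noteq> 0"
  shows "similar_mat (rotation_mat \<theta>) (companion (2 * cos \<theta>))"
proof (rule similar_mat_intertwine)
  let ?P = "mat_of_rows_list 2 [[1, cos \<theta>], [0, sin \<theta>]]"
  let ?Q = "mat_of_rows_list 2 [[1, - cos \<theta> / sin \<theta>], [0, 1 / sin \<theta>]]"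
  \<comment> \<open>Matches the upper right entries, cos^2 - sin^2 and 2 cos^2 - 1.\<close>
  have c: "cos \<theta> * (cos \<theta> * 2) = 1 + (cos \<theta> * cos \<theta> - sin \<theta> * sin \<theta>)"
    using sin_cos_squared_add[of \<theta>] by (simp add: power2_eq_square)
  show "?P \<in> carrier_mat 2 2" "?Q \<in> carrier_mat 2 2" "companion (2 * cos \<theta>) \<in> carrier_mat 2 2"
    by (simp_all add: companion_def mat_of_rows_list_carrier)
  show "?P * ?Q = 1\<^sub>m 2"
    by (rule mult_mat_eqI[where n = 2])
      (use assms in \<open>simp_all add: mat_of_rows_list_carrier,
        simp add: mat_of_rows_list_def upt_rec_numeral upt_rec\<close>)
  show "rotation_mat \<theta> * ?P = ?P * companion (2 * cos \<theta>)"
    by (rule mult_mat_eq_multI[where n = 2])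
      (simp_all add: mat_of_rows_list_carrier companion_def,
        simp add: c rotation_mat_def mat_of_rows_list_def upt_rec
          scalar_prod_def algebra_simps)
qed auto

lemma similar_to_integer_companions_2:
  assumes ne: "x \<noteq> y" and s: "x + y \<in> \<int>" and p: "x * y \<in> \<int>"
  shows "similar_to_integer_mat (diag_block_mat [companion x, companion y])"
proof -
  let ?A = "mat_of_rows_list 4 [[0, -1, 0, 0], [1, x, 0, 0], [0, 0, 0, -1], [0, 0, 1, y]]"
  \<comment> \<open>the Kronecker product of the Vandermonde matrix of x, y with the identity\<close>
  let ?P = "mat_of_rows_list 4 [[1, 0, x, 0], [0, 1, 0, x], [1, 0, y, 0], [0, 1, 0, y]]"
  \<comment> \<open>\<open>d\<close> is the inverse Vandermonde determinant, specified by an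
    equation usable for rewriting.\<close>
  obtain d where d: "d * y = 1 + d * x"
    using ne by (intro that[of "1 / (y - x)"]) (simp add: field_simps)
  let ?Q = "mat_of_rows_list 4 [[y * d, 0, - (x * d), 0], [0, y * d, 0, - (x * d)],
    [- d, 0, d, 0], [0, - d, 0, d]]"
  \<comment> \<open>The scalar in \<open>companion\<close> is replaced by the companion matrix of (T
    - x)(T - y), with rows (0, -x y) and (1, x + y), which the Vandermonde matrix
    diagonalizes.\<close>
  let ?C = "mat_of_rows_list 4 [[0, -1, 0, 0], [1, 0, 0, - (x * y)], [0, 0, 0, -1], [0, 1, 1, x + y]]"
  have "diag_block_mat [companion x, companion y] = ?A"
    by (rule eq_matI)
      (auto simp: companion_def mat_of_rows_list_def numeral_eq_Suc less_Suc_eq Let_def)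
  moreover have "similar_mat ?A ?C"
  proof (rule similar_mat_intertwine)
    show "?P * ?Q = 1\<^sub>m 4"
      by (rule mult_mat_eqI[where n = 4])
        (simp_all add: mat_of_rows_list_carrier,
          simp add: mat_of_rows_list_def upt_rec algebra_simps d)
    show "?A * ?P = ?P * ?C"
      by (rule mult_mat_eq_multI[where n = 4])
        (simp_all add: mat_of_rows_list_carrier,
          simp add: mat_of_rows_list_def upt_rec scalar_prod_def algebra_simps)
  qed (simp_all add: mat_of_rows_list_carrier)
  moreover have "elements_mat ?C \<subseteq> \<int>"
    by (rule elements_mat_of_rows_list) (use s p in auto)
  ultimately show ?thesis unfolding similar_to_integer_mat_def by auto
qed

lemma similar_to_integer_companions_7:
  fixes x y z :: real
  assumes z: "z = - 1 - x - y" and xx: "x * x = y + 2" and xy: "x * y = - 1 - y"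
    and yy: "y * y = 1 - x - y"
  shows "similar_to_integer_mat (diag_block_mat [companion x, companion y, companion z])"
proof -
  let ?A = "mat_of_rows_list 6 [[0, -1, 0, 0, 0, 0], [1, x, 0, 0, 0, 0], [0, 0, 0, -1, 0, 0],
    [0, 0, 1, y, 0, 0], [0, 0, 0, 0, 0, -1], [0, 0, 0, 0, 1, z]]"
  let ?V = "\<lambda>a b c. mat_of_rows_list 6 [[a, 0, b, 0, c, 0], [0, a, 0, b, 0, c],
    [b, 0, c, 0, a, 0], [0, b, 0, c, 0, a], [c, 0, a, 0, b, 0], [0, c, 0, a, 0, b]]"
  \<comment> \<open>\<open>?V x y z\<close> is the Kronecker product of a symmetric 3 by 3 circulant W with the identity. The
    relations give W W = 7 I - 2 J for the all-ones matrix J, so (W - 2 J) / 7 is inverse to W.\<close>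
  let ?P = "?V x y z"
  let ?Q = "?V ((x - 2) / 7) ((y - 2) / 7) ((z - 2) / 7)"
  \<comment> \<open>The scalar in \<open>companion\<close> becomes the matrix with rows (-2, 1, 0),
    (-1, 0, 1), (-2, 1, 1), whose columns are the coordinates of x x, x y, x z in the basis x, y,
    z.\<close>
  let ?C = "mat_of_rows_list 6 [[0, -1, 0, 0, 0, 0], [1, -2, 0, 1, 0, 0], [0, 0, 0, -1, 0, 0],
    [0, -1, 1, 0, 0, 1], [0, 0, 0, 0, 0, -1], [0, -2, 0, 1, 1, 1]]"
  have "diag_block_mat [companion x, companion y, companion z] = ?A"
    by (rule eq_matI)
      (auto simp: companion_def mat_of_rows_list_def numeral_eq_Suc less_Suc_eq Let_def)
  moreover have "similar_mat ?A ?C"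
  proof (rule similar_mat_intertwine)
    show "?P * ?Q = 1\<^sub>m 6"
      by (rule mult_mat_eqI[where n = 6])
        (simp_all add: mat_of_rows_list_carrier,
          simp add: mat_of_rows_list_def upt_rec z algebra_simps diff_divide_distrib
            add_divide_distrib xx xy yy)
    show "?A * ?P = ?P * ?C"
      by (rule mult_mat_eq_multI[where n = 6])
        (simp_all add: mat_of_rows_list_carrier,
          simp add: mat_of_rows_list_def upt_rec z algebra_simps xx xy yy)
  qed (simp_all add: mat_of_rows_list_carrier)
  moreover have "elements_mat ?C \<subseteq> \<int>"
    by (rule elements_mat_of_rows_list) auto
  ultimately show ?thesis unfolding similar_to_integer_mat_def by auto
qed

text \<open>With zero sine the rotation is plus or minus the identity, already integral; otherwise
  its companion form is integral.\<close>

lemma rotation_similar_to_integer: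
  assumes "2 * cos \<theta> \<in> \<int>"
  shows "similar_to_integer_mat (rotation_mat \<theta>)"
proof (cases "sin \<theta> = 0")
  case True
  then have "(cos \<theta>)\<^sup>2 = 1" using sin_cos_squared_add[of \<theta>] by simp
  then have "cos \<theta> \<in> \<int>" by (auto simp: power2_eq_1_iff)
  with True have "elements_mat (rotation_mat \<theta>) \<subseteq> \<int>"
    unfolding rotation_mat_def by (intro elements_mat_of_rows_list) auto
  then show ?thesis unfolding similar_to_integer_mat_def
    using similar_mat_refl[OF rotation_mat_carrier] by blast
next
  case False
  have "elements_mat (companion (2 * cos \<theta>)) \<subseteq> \<int>"
    unfolding companion_def by (rule elements_mat_of_rows_list) (use assms in auto)
  then show ?thesis unfolding similar_to_integer_mat_def
    using rotation_similar_companion[OF False] by blast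
qed

lemma rotations_similar_companions:
  assumes "\<forall>\<theta>\<in>set \<theta>s. sin \<theta> \<noteq> 0"
  shows "similar_mat (diag_block_mat (map rotation_mat \<theta>s))
    (diag_block_mat (map (\<lambda>\<theta>. companion (2 * cos \<theta>)) \<theta>s))"
  using similar_diag_mat_block_mat[of "map (\<lambda>\<theta>. (rotation_mat \<theta>, companion (2 * cos \<theta>))) \<theta>s"]
    rotation_similar_companion assms by (auto simp: comp_def)

lemma rotation_pair_similar_to_integer:
  assumes "sin \<beta> \<noteq> 0" "sin \<gamma> \<noteq> 0" "cos \<beta> \<noteq> cos \<gamma>"
    and "2 * cos \<beta> + 2 * cos \<gamma> \<in> \<int>" "2 * cos \<beta> * (2 * cos \<gamma>) \<in> \<int>"
  shows "similar_to_integer_mat (diag_block_mat [rotation_mat \<beta>, rotation_mat \<gamma>])"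
  using similar_to_integer_trans[OF rotations_similar_companions[of "[\<beta>, \<gamma>]"]]
    similar_to_integer_companions_2[of "2 * cos \<beta>" "2 * cos \<gamma>"] assms by simp

section \<open>Admissibility of the listed triples\<close>

lemma admissibleI:
  assumes "\<alpha> \<noteq> 0" "\<alpha> + \<beta> + \<gamma> = 0"
    and "similar_to_integer_mat (diag_block_mat [rotation_mat \<alpha>, rotation_mat \<beta>, rotation_mat \<gamma>])"
  shows "(\<alpha>, \<beta>, \<gamma>) \<in> admissible_triples"
proof -
  have "\<alpha>\<^sup>2 + \<beta>\<^sup>2 + \<gamma>\<^sup>2 \<noteq> 0" using assms(1)
    by (simp add: add_nonneg_eq_0_iff)
  \<comment> \<open>The triple itself serves as (a, b, c), at time 1.\<close>
  moreover have "(\<alpha>, \<beta>, \<gamma>) = (\<alpha> * 1, \<beta> * 1, \<gamma> * 1)" by simp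
  ultimately show ?thesis unfolding admissible_triples_def mem_Collect_eq phi_def
    using assms(2,3) by (metis mult.right_neutral)
qed

lemma admissible_of_integer_cosines:
  assumes "\<alpha> \<noteq> 0" "\<alpha> + \<beta> + \<gamma> = 0" "2 * cos \<alpha> \<in> \<int>" "2 * cos \<beta> \<in> \<int>" "2 * cos \<gamma> \<in> \<int>"
  shows "(\<alpha>, \<beta>, \<gamma>) \<in> admissible_triples"
  using assms by (intro admissibleI similar_to_integer_diag_block) (auto intro: rotation_similar_to_integer)

lemma admissible_of_integer_cosine:
  assumes "\<alpha> \<noteq> 0" "\<alpha> + \<beta> + \<gamma> = 0" "2 * cos \<alpha> \<in> \<int>"
    and "sin \<beta> \<noteq> 0" "sin \<gamma> \<noteq> 0" "cos \<beta> \<noteq> cos \<gamma>"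
    and "2 * cos \<beta> + 2 * cos \<gamma> \<in> \<int>" "2 * cos \<beta> * (2 * cos \<gamma>) \<in> \<int>"
  shows "(\<alpha>, \<beta>, \<gamma>) \<in> admissible_triples"
proof (rule admissibleI)
  \<comment> \<open>The last two rotations form one block, since only together do they become
    integral; unfolding \<open>diag_block_mat\<close> flattens the nesting.\<close>
  have "similar_to_integer_mat
    (diag_block_mat [rotation_mat \<alpha>, diag_block_mat [rotation_mat \<beta>, rotation_mat \<gamma>]])"
    using rotation_pair_similar_to_integer[OF assms(4-)] rotation_similar_to_integer[OF assms(3)]
    by (intro similar_to_integer_diag_block) auto
  then show "similar_to_integer_mat (diag_block_mat [rotation_mat \<alpha>, rotation_mat \<beta>, rotation_mat \<gamma>])"
    by (simp only: diag_block_mat.simps(2)[of "rotation_mat \<alpha>"] diag_block_mat_singleton)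
qed fact+

lemma cos_sevenths:
  defines "x \<equiv> 2 * cos (2 * pi / 7)" and "y \<equiv> 2 * cos (4 * pi / 7)" and "z \<equiv> 2 * cos (6 * pi / 7)"
  shows "z = - 1 - x - y" "x * x = y + 2" "x * y = - 1 - y" "y * y = 1 - x - y"
proof -
  define t where "t = pi / 7"
  have "sin t > 0" unfolding t_def by (rule sin_gt_zero) auto
  have pi: "pi = 7 * t" by (simp add: t_def)
  have x: "x = 2 * cos (2 * t)" and y: "y = 2 * cos (4 * t)" and z: "z = 2 * cos (6 * t)"
    unfolding x_def y_def z_def pi by simp_all
  \<comment> \<open>Multiplied by \<open>sin t\<close>, the sum of the doubled cosines
    telescopes.\<close>
  have "sin t * x = sin (3 * t) - sin t" "sin t * y = sin (5 * t) - sin (3 * t)"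
    "sin t * z = sin (7 * t) - sin (5 * t)"
    unfolding x y z using sin_times_cos[of t "2 * t"] sin_times_cos[of t "4 * t"]
      sin_times_cos[of t "6 * t"] by simp_all
  moreover have "sin (7 * t) = 0" unfolding pi[symmetric] by simp
  ultimately have "sin t * (x + y + z) = sin t * (- 1)" by (simp add: algebra_simps)
  then have "x + y + z = - 1" using \<open>sin t > 0\<close> unfolding mult_cancel_left by simp
  then show zxy: "z = - 1 - x - y" by simp
  show "x * x = y + 2"
    unfolding x y using cos_times_cos[of "2 * t" "2 * t"] by simp
  show "x * y = - 1 - y"
    using cos_times_cos[of "4 * t" "2 * t"] zxy unfolding x y z
    by (simp add: mult.commute[of "cos (4 * t)"])
  \<comment> \<open>Since 14 t is a full turn, the term from y y with angle 8 t reduces to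
    z.\<close>
  have "cos (8 * t) = cos (2 * pi - 6 * t)" unfolding pi by simp
  also have "\<dots> = cos (6 * t)" by (simp add: cos_diff)
  finally show "y * y = 1 - x - y"
    using cos_times_cos[of "4 * t" "4 * t"] zxy unfolding x y z by simp
qed

lemma cos_values:
  "cos (5 * pi / 6) = - (sqrt 3 / 2)" "cos (3 * pi / 4) = - (sqrt 2 / 2)" "cos (4 * pi) = 1"
  "cos (3 * pi / 2) = 0" "cos (5 * pi / 3) = 1 / 2" "cos (4 * pi / 3) = - 1 / 2"
proof -
  have *: "cos a = - cos b" if "a = pi - b" for a b :: real unfolding that by simp
  have **: "cos a = cos b" if "a = 2 * pi - b" for a b :: real unfolding that by (simp add: cos_diff)
  show "cos (5 * pi / 6) = - (sqrt 3 / 2)" using *[of "5 * pi / 6" "pi / 6"] by (simp add: cos_30)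
  show "cos (3 * pi / 4) = - (sqrt 2 / 2)" using *[of "3 * pi / 4" "pi / 4"] by (simp add: cos_45)
  show "cos (4 * pi) = 1" using cos_int_2pin[of 2] by simp
  show "cos (3 * pi / 2) = 0" using **[of "3 * pi / 2" "pi / 2"] by simp
  show "cos (5 * pi / 3) = 1 / 2" using **[of "5 * pi / 3" "pi / 3"] by (simp add: cos_60)
  show "cos (4 * pi / 3) = - 1 / 2" using **[of "4 * pi / 3" "2 * pi / 3"] by (simp add: cos_120)
qed

lemma listed_subset_admissible: "listed_triples \<subseteq> admissible_triples"
proof -
  have s: "sin (pi / 6) \<noteq> 0" "sin (5 * pi / 6) \<noteq> 0" "sin (pi / 4) \<noteq> 0" "sin (3 * pi / 4) \<noteq> 0"
    by (rule less_imp_neq[OF sin_gt_zero, symmetric]; simp)+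
  have s7: "sin (2 * pi / 7) \<noteq> 0" "sin (4 * pi / 7) \<noteq> 0" "sin (6 * pi / 7) \<noteq> 0"
    by (rule less_imp_neq[OF sin_gt_zero, symmetric]; simp)+
  note c = cos_values cos_30 cos_45 cos_60 cos_120
  have "(2 * pi / 7, 4 * pi / 7, - (6 * pi / 7)) \<in> admissible_triples"
    using similar_to_integer_trans[OF
        rotations_similar_companions[of "[2 * pi / 7, 4 * pi / 7, - (6 * pi / 7)]"]]
      similar_to_integer_companions_7[OF cos_sevenths] s7
    by (intro admissibleI) simp_all
  \<comment> \<open>The last two doubled cosines are opposite square roots of 3 or 2, with sum 0 and
    product -3 or -2.\<close>
  moreover have "(pi, - (pi / 6), - (5 * pi / 6)) \<in> admissible_triples"
    "(2 * pi / 3, pi / 6, - (5 * pi / 6)) \<in> admissible_triples"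
    "(pi, - (pi / 4), - (3 * pi / 4)) \<in> admissible_triples"
    "(pi / 2, pi / 4, - (3 * pi / 4)) \<in> admissible_triples"
    by (rule admissible_of_integer_cosine; use s in \<open>simp add: c\<close>)+
  moreover have "(2 * pi, 2 * pi, - (4 * pi)) \<in> admissible_triples"
    "(2 * pi, - pi, - pi) \<in> admissible_triples"
    "(2 * pi, - (pi / 2), - (3 * pi / 2)) \<in> admissible_triples"
    "(2 * pi, - (pi / 3), - (5 * pi / 3)) \<in> admissible_triples"
    "(2 * pi, - (2 * pi / 3), - (4 * pi / 3)) \<in> admissible_triples"
    "(pi, - (pi / 2), - (pi / 2)) \<in> admissible_triples"
    "(pi, - (2 * pi / 3), - (pi / 3)) \<in> admissible_triples"
    "(pi / 3, pi / 3, - (2 * pi / 3)) \<in> admissible_triples"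
    "(2 * pi / 3, 2 * pi / 3, - (4 * pi / 3)) \<in> admissible_triples"
    by (rule admissible_of_integer_cosines; simp add: c)+
  ultimately show ?thesis unfolding listed_triples_def by (simp only: insert_subset empty_subsetI simp_thms)
qed

section \<open>Values at the listed triples and the classification\<close>

lemma listed_triples_values:
  obtains L where "set L = listed_triples"
    "map (\<lambda>q. (cos_e1 q, cos_e2 q)) L = [(-1, -2), (-2, -3), (-1, -3), (-2, -2), (0, -2), (6, 12),
      (-2, -4), (2, 0), (4, 5), (0, -3), (-2, 0), (-2, -1), (1, -1), (-3, 3)]"
proof -
  have "cos_e1 (2 * pi / 7, 4 * pi / 7, - (6 * pi / 7)) = - 1"
    using cos_sevenths(1) by (simp add: cos_e1_def)
  moreover have "cos_e2 (2 * pi / 7, 4 * pi / 7, - (6 * pi / 7)) = - 2"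
  proof -
    define x y z where "x = 2 * cos (2 * pi / 7)" "y = 2 * cos (4 * pi / 7)" "z = 2 * cos (6 * pi / 7)"
    note * = cos_sevenths[folded this]
    have "cos_e2 (2 * pi / 7, 4 * pi / 7, - (6 * pi / 7)) = x * y + y * z + z * x"
      by (simp add: cos_e2_def x_y_z_def)
    also have "\<dots> = - 2" using *(2-4) unfolding *(1) by (simp add: algebra_simps)
    finally show ?thesis .
  qed
  ultimately show ?thesis
    \<comment> \<open>A list in the order of \<open>listed_triples\<close> keeps each value paired
      with its triple.\<close>
    by (intro that[of "[(2 * pi / 7, 4 * pi / 7, - (6 * pi / 7)),
     (pi, - (pi / 6), - (5 * pi / 6)), (2 * pi / 3, pi / 6, - (5 * pi / 6)),
     (pi, - (pi / 4), - (3 * pi / 4)), (pi / 2, pi / 4, - (3 * pi / 4)),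
     (2 * pi, 2 * pi, - (4 * pi)), (2 * pi, - pi, - pi), (2 * pi, - (pi / 2), - (3 * pi / 2)),
     (2 * pi, - (pi / 3), - (5 * pi / 3)), (2 * pi, - (2 * pi / 3), - (4 * pi / 3)),
     (pi, - (pi / 2), - (pi / 2)), (pi, - (2 * pi / 3), - (pi / 3)),
     (pi / 3, pi / 3, - (2 * pi / 3)), (2 * pi / 3, 2 * pi / 3, - (4 * pi / 3))]"])
     (simp only: listed_triples_def list.set,
      simp add: cos_e1_def[abs_def] cos_e2_def cos_values cos_30 cos_45 cos_60 cos_120)
qed

text \<open>Uniqueness of \<open>q\<close> makes the listed triples pairwise inequivalent.\<close>

theorem proposition4p3:
  shows "listed_triples \<subseteq> admissible_triples \<and>
    (\<forall>p\<in>admissible_triples. \<exists>!q. q \<in> listed_triples \<and> triple_equiv p q)"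
proof (intro conjI ballI)
  show "listed_triples \<subseteq> admissible_triples" by (rule listed_subset_admissible)
  fix p assume "p \<in> admissible_triples"
  then obtain a b c t where p: "p = (a * t, b * t, c * t)" and sum: "a * t + b * t + c * t = 0"
    and sim: "similar_to_integer_mat (phi a b c t)"
    unfolding admissible_triples_def by auto
  let ?f = "\<lambda>q. (cos_e1 q, cos_e2 q)"
  obtain L where L: "set L = listed_triples" "map ?f L = [(-1, -2), (-2, -3), (-1, -3), (-2, -2),
    (0, -2), (6, 12), (-2, -4), (2, 0), (4, 5), (0, -3), (-2, 0), (-2, -1), (1, -1), (-3, 3)]"
    by (rule listed_triples_values)
  \<comment> \<open>The fourteen value pairs differ, so \<open>?f\<close> is injective on the list;
    this yields uniqueness.\<close>
  have "distinct (map ?f L)" unfolding L(2) by simp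
  then have inj: "inj_on ?f listed_triples" unfolding distinct_map L(1) by simp
  have "cos_e1 p \<in> \<int>" "cos_e2 p \<in> \<int>"
    using integer_symmetric_functions[OF sim] unfolding p cos_e1_def cos_e2_def by simp_all
  then have "?f p \<in> set (map ?f L)"
    using cos_e_in_listed_values[OF sum] unfolding L(2) p by auto
  then obtain q where q: "q \<in> listed_triples" "?f q = ?f p" unfolding set_map L(1) by auto
  \<comment> \<open>Every listed triple has sum 0, so \<open>triple_equiv_iff\<close>
    applies.\<close>
  have equiv: "triple_equiv p r \<longleftrightarrow> ?f p = ?f r" if "r \<in> listed_triples" for r
  proof -
    have "fst r + fst (snd r) + snd (snd r) = 0" using that unfolding listed_triples_def by auto
    then show ?thesis using triple_equiv_iff[OF p sum, of r "fst r" "fst (snd r)" "snd (snd r)"] by simp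
  qed
  show "\<exists>!q. q \<in> listed_triples \<and> triple_equiv p q"
  proof (rule ex1I[of _ q])
    show "q \<in> listed_triples \<and> triple_equiv p q" using q equiv by simp
    fix r assume "r \<in> listed_triples \<and> triple_equiv p r"
    then show "r = q" using q equiv by (metis (no_types, lifting) inj inj_onD)
  qed
qed

end
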